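(* Let $Z$ be a topological space and let $Y$ be a regular locally $Z$-compact space. Then the topology $t^Z_{co}$ on $C(Y,Z)$ is admissible.
   Context: For a topological space $X$, $\mathcal{O}(X)$ denotes the family of all open subsets of $X$. $C(Y,Z)$ is the set of all continuous maps from $Y$ to $Z$, and $\mathcal{O}_Z(Y)=\{f^{-1}(U): f\in C(Y,Z),\ U\in\mathcal{O}(Z)\}$. $\tau_Y^Z$ is the topology on $Y$ having $\mathcal{O}_Z(Y)$ as a subbasis. A subset $K\subseteq Y$ is $Z$-compact if it is compact in $(Y,\tau_Y^Z)$. The space $Y$ is locally $Z$-compact if the space $(Y,\tau_Y^Z)$ is locally compact. The topology $t_{co}^Z$ on $C(Y,Z)$ has as a subbasis all sets $(K,U)=\{f\in C(Y,Z): f(K)\subseteq U\}$ with $K\subseteq Y$ $Z$-compact and $U\in\mathcal{O}(Z)$. A topology $t$ on $C(Y,Z)$ is admissible if for every space $X$ and every map $G:X\to C(Y,Z)$, continuity of $G:X\to (C(Y,Z),t)$ implies continuity of $\widetilde{G}:X\times Y\to Z$, $\widetilde{G}(x,y)=G(x)(y)$; equivalently, the evaluation map $e:(C(Y,Z),t)\times Y\to Z$, $e(f,y)=f(y)$, is continuous (here $Y$ carries its original topology).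
   Formalization: "Regular locally Z-compact" is taken to mean: Y is regular and its Z-topology has a base of compact neighbourhoods at each point, or the Z-topology is regular and locally compact. With Y regular and only one Z-compact neighbourhood per point, the claim is false. *)

theory Defs
  imports "HOL-Analysis.Analysis"
begin

text \<open>
  The topology on \<open>A\<close> with subbasis \<open>S\<close>. Intersections are taken relative to \<open>A\<close>, so the
  empty intersection is \<open>A\<close> and the carrier is \<open>A\<close> even when \<open>S\<close> does not cover it
  (\<^const>\<open>topology_generated_by\<close> would have carrier \<open>\<Union>S\<close>).
\<close>

definition topology_with_subbasis :: "'a set \<Rightarrow> 'a set set \<Rightarrow> 'a topology" where
  "topology_with_subbasis A S =
     topology (arbitrary union_of (finite intersection_of (\<lambda>U. U \<in> S) relative_to A))"

text \<open>
  Maps are made extensional, so that a continuous map on a carrier that is not the whole type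
  is represented by exactly one HOL function.
\<close>

definition cmaps :: "'a topology \<Rightarrow> 'b topology \<Rightarrow> ('a \<Rightarrow> 'b) set" where
  "cmaps Y Z = {f. continuous_map Y Z f \<and> f \<in> extensional (topspace Y)}"

definition Z_opens :: "'a topology \<Rightarrow> 'b topology \<Rightarrow> 'a set set" where
  "Z_opens Y Z = {{y \<in> topspace Y. f y \<in> U} | f U. f \<in> cmaps Y Z \<and> openin Z U}"

definition Z_topology :: "'a topology \<Rightarrow> 'b topology \<Rightarrow> 'a topology" where
  "Z_topology Y Z = topology_with_subbasis (topspace Y) (Z_opens Y Z)"

definition Z_compact :: "'a topology \<Rightarrow> 'b topology \<Rightarrow> 'a set \<Rightarrow> bool" where
  "Z_compact Y Z K \<longleftrightarrow> compactin (Z_topology Y Z) K"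

definition co_topology :: "'a topology \<Rightarrow> 'b topology \<Rightarrow> ('a \<Rightarrow> 'b) topology" where
  "co_topology Y Z = topology_with_subbasis (cmaps Y Z)
     {{f \<in> cmaps Y Z. f ` K \<subseteq> U} | K U. Z_compact Y Z K \<and> openin Z U}"

text \<open>
  The definition of admissibility ranges over all spaces \<open>X\<close>. HOL cannot quantify over types
  inside a formula, so the type of the points of \<open>X\<close> is a parameter; a theorem about
  \<open>admissible TYPE('x)\<close> with \<open>'x\<close> a type variable speaks about spaces over every type.
  The instance \<open>X = t\<close>, \<open>G = id\<close> is continuity of the evaluation map.
\<close>

definition admissible ::
  "'x itself \<Rightarrow> 'a topology \<Rightarrow> 'b topology \<Rightarrow> ('a \<Rightarrow> 'b) topology \<Rightarrow> bool" where
  "admissible _ Y Z t \<longleftrightarrow>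
     (\<forall>(X :: 'x topology) G. continuous_map X t G \<longrightarrow>
        continuous_map (prod_topology X Y) Z (\<lambda>(x, y). G x y))"

text \<open>
  The library's \<^const>\<open>locally_compact_space\<close> asks for one compact neighbourhood of every point and
  includes no separation axiom. \<open>Z_topology Y Z\<close> is in general strictly coarser than \<open>Y\<close>, and
  regularity of \<open>Y\<close> does not make it regular, so regularity of \<open>Y\<close> does not provide arbitrarily
  small compact neighbourhoods in \<open>Z_topology Y Z\<close>.
\<close>

definition locally_Z_compact :: "'a topology \<Rightarrow> 'b topology \<Rightarrow> bool" where
  "locally_Z_compact Y Z \<longleftrightarrow> locally_compact_space (Z_topology Y Z)"

text \<open>
  The other common meaning of local compactness for spaces that need not be Hausdorff:
  every point has a neighbourhood base of compact sets.
\<close>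

definition strongly_locally_Z_compact :: "'a topology \<Rightarrow> 'b topology \<Rightarrow> bool" where
  "strongly_locally_Z_compact Y Z \<longleftrightarrow>
     neighbourhood_base_of (compactin (Z_topology Y Z)) (Z_topology Y Z)"

end

theory Submission
  imports Defs
begin

text \<open>
  If \<open>G x y \<in> U\<close>, the preimage of \<open>U\<close> under \<open>G x\<close> is open in the topology \<open>\<tau>\<close> of \<open>Z_topology Y Z\<close>.
  Hence there is a \<open>\<tau>\<close>-compact \<open>\<tau>\<close>-neighbourhood \<open>K\<close> of \<open>y\<close> inside it, so \<open>G x\<close> lies in the
  subbasic open set \<open>(K, U)\<close>, and evaluation maps \<open>(K, U) \<times> K\<close> into \<open>U\<close>.
  Since \<open>\<tau>\<close> is coarser than \<open>Y\<close>, \<open>K\<close> is also a neighbourhood of \<open>y\<close> in \<open>Y\<close>.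
\<close>

lemma openin_topology_with_subbasis:
  "openin (topology_with_subbasis A S) =
     arbitrary union_of (finite intersection_of (\<lambda>U. U \<in> S) relative_to A)"
  unfolding topology_with_subbasis_def
  by (rule topology_inverse'[OF istopology_subbase])

lemma topspace_topology_with_subbasis [simp]: "topspace (topology_with_subbasis A S) = A"
  unfolding topology_with_subbasis_def by (rule topspace_subbase)

lemma openin_subbasis:
  assumes "U \<in> S" "U \<subseteq> A"
  shows "openin (topology_with_subbasis A S) U"
proof -
  have "(finite intersection_of (\<lambda>U. U \<in> S) relative_to A) (A \<inter> U)"
    by (intro relative_to_inc finite_intersection_of_inc assms)
  then have "(finite intersection_of (\<lambda>U. U \<in> S) relative_to A) U"
    using assms by (simp add: Int_absorb1)
  then show ?thesis
    unfolding openin_topology_with_subbasis by (rule arbitrary_union_of_inc)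
qed

text \<open>It suffices to check the subbasis, since openness in \<open>X\<close> survives finite
  intersections and arbitrary unions.\<close>

lemma openin_topology_with_subbasis_coarser:
  assumes "openin (topology_with_subbasis (topspace X) S) W" "\<And>U. U \<in> S \<Longrightarrow> openin X U"
  shows "openin X W"
proof -
  have *: "openin X V" if "(finite intersection_of (\<lambda>U. U \<in> S) relative_to topspace X) V" for V
  proof -
    from that obtain F where "finite F" "F \<subseteq> S" "V = topspace X \<inter> \<Inter>F"
      unfolding relative_to_def intersection_of_def by (elim exE conjE) simp
    then show ?thesis
      \<comment> \<open>\<open>openin_Inter\<close> needs a nonempty family; for empty
        \<open>F\<close> the set \<open>V\<close> is \<open>topspace X\<close> itself.\<close>
      using assms(2) by (cases "F = {}") (auto intro!: openin_Int openin_Inter)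
  qed
  obtain \<U> where "\<And>V. V \<in> \<U> \<Longrightarrow> openin X V" "W = \<Union>\<U>"
    using assms(1) * by (auto simp: openin_topology_with_subbasis union_of_def)
  then show ?thesis by auto
qed

lemma openin_Z_topology_preimage:
  assumes "f \<in> cmaps Y Z" "openin Z U"
  shows "openin (Z_topology Y Z) {y \<in> topspace Y. f y \<in> U}"
  unfolding Z_topology_def Z_opens_def using assms by (intro openin_subbasis) auto

text \<open>The subbasic sets are preimages of open sets under maps continuous on
  \<open>Y\<close>.\<close>

lemma openin_Z_topology_imp_openin:
  assumes "openin (Z_topology Y Z) W"
  shows "openin Y W"
  using assms unfolding Z_topology_def
  by (rule openin_topology_with_subbasis_coarser)
     (auto simp: Z_opens_def cmaps_def intro: openin_continuous_map_preimage)

lemma openin_co_topology: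
  assumes "Z_compact Y Z K" "openin Z U"
  shows "openin (co_topology Y Z) {f \<in> cmaps Y Z. f ` K \<subseteq> U}"
  unfolding co_topology_def using assms by (intro openin_subbasis) auto

lemma admissible_co_topology:
  fixes Y :: "'a topology" and Z :: "'b topology"
  assumes "strongly_locally_Z_compact Y Z"
  shows "admissible TYPE('x) Y Z (co_topology Y Z)"
  unfolding admissible_def
proof (intro allI impI)
  fix X :: "'x topology" and G
  assume G: "continuous_map X (co_topology Y Z) G"
  \<comment> \<open>The carrier of \<open>co_topology Y Z\<close> is exactly
    \<open>cmaps Y Z\<close>, because intersections are taken relative to it.\<close>
  have Gc: "G x \<in> cmaps Y Z" if "x \<in> topspace X" for x
    using continuous_map_image_subset_topspace[OF G] that by (auto simp: co_topology_def)
  show "continuous_map (prod_topology X Y) Z (\<lambda>(x, y). G x y)"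
    unfolding continuous_map_def
  proof (intro conjI allI impI)
    show "(\<lambda>(x, y). G x y) \<in> topspace (prod_topology X Y) \<rightarrow> topspace Z"
      using Gc by (auto simp: cmaps_def continuous_map_def)
    fix U assume U: "openin Z U"
    show "openin (prod_topology X Y) {p \<in> topspace (prod_topology X Y). (case p of (x, y) \<Rightarrow> G x y) \<in> U}"
      unfolding openin_prod_topology_alt
    proof (intro allI impI)
      fix x y
      assume "(x, y) \<in> {p \<in> topspace (prod_topology X Y). (case p of (x, y) \<Rightarrow> G x y) \<in> U}"
      then have x: "x \<in> topspace X" and y: "y \<in> topspace Y" and xy: "G x y \<in> U" by auto
      have "openin (Z_topology Y Z) {y \<in> topspace Y. G x y \<in> U}"
        by (rule openin_Z_topology_preimage[OF Gc[OF x] U])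
      then obtain W K where W: "openin (Z_topology Y Z) W" "y \<in> W" "W \<subseteq> K"
        and K: "compactin (Z_topology Y Z) K" "K \<subseteq> {y \<in> topspace Y. G x y \<in> U}"
        using assms y xy unfolding strongly_locally_Z_compact_def neighbourhood_base_of
        by (metis (mono_tags, lifting) mem_Collect_eq)
      define N where "N = {x \<in> topspace X. G x \<in> {f \<in> cmaps Y Z. f ` K \<subseteq> U}}"
      have "openin X N"
        unfolding N_def using K(1) U
        by (intro openin_continuous_map_preimage[OF G] openin_co_topology) (auto simp: Z_compact_def)
      moreover have "openin Y W"
        using W(1) by (rule openin_Z_topology_imp_openin)
      moreover have "x \<in> N"
        using x Gc K(2) by (auto simp: N_def)
      \<comment> \<open>Second coordinates lie in \<open>W \<subseteq> K\<close>, and every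
        \<open>G x\<close> with \<open>x \<in> N\<close> sends \<open>K\<close> into
        \<open>U\<close>.\<close>
      moreover have "N \<times> W \<subseteq> {p \<in> topspace (prod_topology X Y). (case p of (x, y) \<Rightarrow> G x y) \<in> U}"
        using W(3) K(2) by (auto simp: N_def)
      ultimately show "\<exists>N W. openin X N \<and> openin Y W \<and> x \<in> N \<and> y \<in> W \<and>
          N \<times> W \<subseteq> {p \<in> topspace (prod_topology X Y). (case p of (x, y) \<Rightarrow> G x y) \<in> U}"
        using W(2) by blast
    qed
  qed
qed

text \<open>In a regular space, closed neighbourhoods can be shrunk into a given compact one, which
  yields a base of compact neighbourhoods. The regularity meant here is that of the coarser
  topology.\<close>

lemma strongly_locally_Z_compact_regular:
  assumes "regular_space (Z_topology Y Z)" "locally_Z_compact Y Z"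
  shows "strongly_locally_Z_compact Y Z"
proof -
  have "neighbourhood_base_of
      (\<lambda>C. compactin (Z_topology Y Z) C \<and> closedin (Z_topology Y Z) C) (Z_topology Y Z)"
    using assms unfolding locally_Z_compact_def
    by (intro iffD1[OF locally_compact_regular_space_neighbourhood_base] conjI)
  then show ?thesis
    unfolding strongly_locally_Z_compact_def by (rule neighbourhood_base_of_mono) simp
qed

text \<open>The disjunction covers two readings of local compactness: a base of compact
  neighbourhoods, or one compact neighbourhood per point with regularity placed on
  \<open>Z_topology Y Z\<close>. The second reduces to the first.\<close>

theorem theorem2p6:
  fixes Y :: "'a topology" and Z :: "'b topology"
  assumes "regular_space Y \<and> strongly_locally_Z_compact Y Z \<or>
           regular_space (Z_topology Y Z) \<and> locally_Z_compact Y Z"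
  shows "admissible TYPE('x) Y Z (co_topology Y Z)"
  using assms admissible_co_topology strongly_locally_Z_compact_regular by blast

end
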